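(* Let $K\subset\mathbb{R}^2$ be a (non-degenerate) triangle with vertices $\mathbf{a}_1,\mathbf{a}_2,\mathbf{a}_3$ and area $|K|$, and let $\boldsymbol{\ell}_1=\mathbf{a}_3-\mathbf{a}_2$, $\boldsymbol{\ell}_2=\mathbf{a}_1-\mathbf{a}_3$, $\boldsymbol{\ell}_3=\mathbf{a}_2-\mathbf{a}_1$ be its edge vectors. Let $u$ be a quadratic function on $K$ with (constant) Hessian matrix $H$, and let $u_I$ be the Lagrangian linear interpolant of $u$ at the three vertices of $K$. Then $$\|\nabla(u-u_I)\|_{L^2(K)}^2=\frac{1}{48|K|}\sum_{i=1}^{3}c_i^2\,|\boldsymbol{\ell}_i|^2,\qquad c_i=\boldsymbol{\ell}_{i+1}\cdot H\boldsymbol{\ell}_{i+2},$$ where the indices are taken modulo $3$ in $\{1,2,3\}$.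
   Context: A quadratic function is a real polynomial in two variables of total degree at most $2$. The Lagrangian linear interpolant $u_I$ on $K$ is the unique affine function (polynomial of degree at most $1$) with $u_I(\mathbf{a}_i)=u(\mathbf{a}_i)$ for $i=1,2,3$. The symbol $|\boldsymbol{\ell}_i|$ denotes the Euclidean length, $\cdot$ the Euclidean inner product, and $\|\nabla v\|_{L^2(K)}^2=\int_K|\nabla v(\mathbf{x})|^2\,d\mathbf{x}$. The index convention means $\boldsymbol{\ell}_{4}=\boldsymbol{\ell}_1$ and $\boldsymbol{\ell}_5=\boldsymbol{\ell}_2$, so $c_1=\boldsymbol{\ell}_2\cdot H\boldsymbol{\ell}_3$, $c_2=\boldsymbol{\ell}_3\cdot H\boldsymbol{\ell}_1$, $c_3=\boldsymbol{\ell}_1\cdot H\boldsymbol{\ell}_2$. *)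

theory Defs
  imports "HOL-Analysis.Analysis"
begin

definition poly2_degree_le :: "nat \<Rightarrow> (real^2 \<Rightarrow> real) \<Rightarrow> bool" where
  "poly2_degree_le d p \<longleftrightarrow>
     (\<exists>k :: nat \<Rightarrow> nat \<Rightarrow> real.
        \<forall>x. p x = (\<Sum>(i, j) \<in> {(i, j). i + j \<le> d}. k i j * (x $ 1) ^ i * (x $ 2) ^ j))"

(* Vertices are indexed by the three-element type 3, whose arithmetic is modulo 3 (so 3 = 0). *)

definition linear_interpolant :: "(3 \<Rightarrow> real^2) \<Rightarrow> (real^2 \<Rightarrow> real) \<Rightarrow> real^2 \<Rightarrow> real" where
  "linear_interpolant a u = (THE p. poly2_degree_le 1 p \<and> (\<forall>i. p (a i) = u (a i)))"

definition gradient :: "(real^'n \<Rightarrow> real) \<Rightarrow> real^'n \<Rightarrow> real^'n" where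
  "gradient v x = (\<chi> i. frechet_derivative v (at x) (axis i 1))"

definition hessian :: "(real^'n \<Rightarrow> real) \<Rightarrow> real^'n \<Rightarrow> real^'n^'n" where
  "hessian v x = jacobian (gradient v) (at x)"

end

theory Submission
  imports Defs
begin

text \<open>
  With edge vectors \<open>b\<close>, \<open>d\<close> from the first vertex, the gradient \<open>w\<close> of the interpolation error
  is affine on \<open>K\<close>, \<open>w = w\<^sub>0 + s H b + t H d\<close> in affine coordinates \<open>(s, t)\<close>. That the error vanishes
  at the vertices says exactly \<open>w\<^sub>0 \<bullet> b = - (b \<bullet> H b) / 2\<close> and \<open>w\<^sub>0 \<bullet> d = - (d \<bullet> H d) / 2\<close>, which
  determines \<open>w\<close> through \<open>b \<bullet> H b\<close>, \<open>b \<bullet> H d\<close> and \<open>d \<bullet> H d\<close>. Integrating the quadratic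
  \<open>\<bar>w\<bar>\<^sup>2\<close> over the standard triangle then leaves a polynomial identity.
\<close>

section \<open>Lebesgue measure on the plane and integration over the standard triangle\<close>

lemma Basis_real2: "(Basis :: (real^2) set) = {axis 1 1, axis 2 1}"
  by (auto simp: Basis_vec_def UNIV_2)

lemma measurable_vector2:
  "(\<lambda>(x, y). vector [x, y] :: real^2) \<in> lborel \<Otimes>\<^sub>M lborel \<rightarrow>\<^sub>M borel"
proof -
  have "(\<lambda>(x, y). vector [x, y] :: real^2) = (\<lambda>z. fst z *\<^sub>R axis 1 1 + snd z *\<^sub>R axis 2 1)"
    by (auto simp: vec_eq_iff forall_2 axis_def)
  then have "continuous_on UNIV (\<lambda>(x, y). vector [x, y] :: real^2)"
    by (auto intro!: continuous_intros)
  then show ?thesis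
    unfolding lborel_prod by (simp add: borel_measurable_continuous_onI)
qed

text \<open>Lebesgue measure is determined by its values on boxes, and the preimage of a box is a
  product of two intervals. This opens \<open>real^2\<close> to Fubini's theorem.\<close>

lemma lborel_real2_eq_distr:
  "(lborel :: (real^2) measure) = distr (lborel \<Otimes>\<^sub>M lborel) borel (\<lambda>(x, y). vector [x, y])"
proof (rule lborel_eqI)
  fix l u :: "real^2"
  assume lu: "\<And>b. b \<in> Basis \<Longrightarrow> l \<bullet> b \<le> u \<bullet> b"
  have le: "l $ 1 \<le> u $ 1" "l $ 2 \<le> u $ 2"
    using lu[of "axis 1 1"] lu[of "axis 2 1"] by (auto simp: Basis_real2 inner_axis)
  have "(\<lambda>(x, y). vector [x, y] :: real^2) -` box l u \<inter> space (lborel \<Otimes>\<^sub>M lborel)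
      = {l $ 1 <..< u $ 1} \<times> {l $ 2 <..< u $ 2}"
    by (auto simp: mem_box_cart forall_2 space_pair_measure)
  then show "emeasure (distr (lborel \<Otimes>\<^sub>M lborel) borel (\<lambda>(x, y). vector [x, y])) (box l u)
      = (\<Prod>b\<in>Basis. (u - l) \<bullet> b)"
    using le measurable_vector2
    by (simp add: emeasure_distr lborel.emeasure_pair_measure_Times Basis_real2 inner_axis
        axis_eq_axis ennreal_mult inner_diff_left)
qed simp

definition standard_triangle :: "(real^2) set" where
  "standard_triangle = {x. 0 \<le> x $ 1 \<and> 0 \<le> x $ 2 \<and> x $ 1 + x $ 2 \<le> 1}"

lemma compact_standard_triangle: "compact standard_triangle"
proof -
  have "closed standard_triangle"
    unfolding standard_triangle_def by (intro closed_Collect_conj closed_Collect_le continuous_intros)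
  moreover have "standard_triangle \<subseteq> cbox 0 1"
    by (auto simp: standard_triangle_def mem_box_cart forall_2)
  ultimately show ?thesis
    by (meson bounded_cbox bounded_subset compact_eq_bounded_closed)
qed

text \<open>Fubini: integrate over \<open>0 \<le> y \<le> 1 - x\<close>, then over
  \<open>0 \<le> x \<le> 1\<close>. The fractions are the moments of the triangle up to order
  two.\<close>

lemma integral_quadratic_standard_triangle:
  fixes f :: "real^2 \<Rightarrow> real"
  assumes f: "\<And>x. f x = \<alpha> + \<beta> * x $ 1 + \<gamma> * x $ 2 + \<delta> * (x $ 1)\<^sup>2 + \<epsilon> * (x $ 1 * x $ 2) + \<zeta> * (x $ 2)\<^sup>2"
  shows "(LINT x:standard_triangle|lborel. f x) = \<alpha> / 2 + (\<beta> + \<gamma>) / 6 + (\<delta> + \<zeta>) / 12 + \<epsilon> / 24"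
proof -
  let ?T = "standard_triangle"
  let ?v = "\<lambda>(x, y). vector [x, y] :: real^2"
  let ?g = "\<lambda>x y. \<alpha> + \<beta> * x + \<gamma> * y + \<delta> * x\<^sup>2 + \<epsilon> * (x * y) + \<zeta> * y\<^sup>2"
  \<comment> \<open>\<open>?G x\<close> is the antiderivative of \<open>?g x\<close> that vanishes
    at 0, and \<open>?P\<close> is an antiderivative of \<open>?G x (1 - x)\<close>. Because of the
    powers of \<open>1 - x\<close>, the \<gamma> and \<zeta> terms of the result come from
    \<open>?P 0\<close>.\<close>
  let ?G = "\<lambda>x y. \<alpha> * y + \<beta> * x * y + \<gamma> * y\<^sup>2 / 2 + \<delta> * x\<^sup>2 * y + \<epsilon> * x * y\<^sup>2 / 2 + \<zeta> * y^3 / 3"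
  let ?P = "\<lambda>x. \<alpha> * (x - x\<^sup>2 / 2) + \<beta> * (x\<^sup>2 / 2 - x^3 / 3) - \<gamma> * (1 - x)^3 / 6
    + \<delta> * (x^3 / 3 - x^4 / 4) + \<epsilon> * (x\<^sup>2 / 2 - 2 * x^3 / 3 + x^4 / 4) / 2 - \<zeta> * (1 - x)^4 / 12"
  have contf: "continuous_on ?T f"
    unfolding f by (intro continuous_intros)
  have int: "integrable lborel (\<lambda>x. indicator ?T x *\<^sub>R f x)"
    using compact_standard_triangle contf by (rule borel_integrable_compact)
  then have mf: "(\<lambda>x. indicator ?T x *\<^sub>R f x) \<in> borel_measurable borel"
    by simp
  have int2: "integrable (lborel \<Otimes>\<^sub>M lborel) (\<lambda>z. indicator ?T (?v z) *\<^sub>R f (?v z))"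
    using int unfolding lborel_real2_eq_distr by (subst (asm) integrable_distr_eq[OF measurable_vector2 mf])
  have inner: "(LINT y|lborel. indicator ?T (?v (x, y)) *\<^sub>R f (?v (x, y)))
      = ?G x (1 - x) * indicator {0..1} x" for x
  proof (cases "0 \<le> x \<and> x \<le> 1")
    case True
    have "(LINT y|lborel. indicator ?T (?v (x, y)) *\<^sub>R f (?v (x, y)))
        = (LINT y|lborel. ?g x y * indicator {0..1 - x} y)"
      using True by (intro Bochner_Integration.integral_cong)
        (auto simp: standard_triangle_def f indicator_def)
    also have "\<dots> = ?G x (1 - x) - ?G x 0"
      using True
      by (intro integral_FTC_Icc_real)
        (auto intro!: derivative_eq_intros continuous_intros simp: field_simps power2_eq_square)
    finally show ?thesis using True by simp
  next
    case False
    then have "indicator ?T (?v (x, y)) = (0::real)" for y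
      by (auto simp: standard_triangle_def indicator_def)
    with False show ?thesis by (auto simp: indicator_def)
  qed
  have "(LINT x:?T|lborel. f x) = (LINT z|(lborel \<Otimes>\<^sub>M lborel). indicator ?T (?v z) *\<^sub>R f (?v z))"
    unfolding set_lebesgue_integral_def
    by (subst lborel_real2_eq_distr) (rule integral_distr[OF measurable_vector2 mf])
  also have "\<dots> = (LINT x|lborel. LINT y|lborel. indicator ?T (?v (x, y)) *\<^sub>R f (?v (x, y)))"
    by (rule lborel_pair.integral_fst'[OF int2, symmetric])
  also have "\<dots> = (LINT x|lborel. ?G x (1 - x) * indicator {0..1} x)"
    by (simp only: inner)
  also have "\<dots> = ?P 1 - ?P 0"
    by (intro integral_FTC_Icc_real)
      (auto intro!: derivative_eq_intros continuous_intros
        simp: field_simps power2_eq_square power3_eq_cube power4_eq_xxxx)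
  also have "\<dots> = \<alpha> / 2 + (\<beta> + \<gamma>) / 6 + (\<delta> + \<zeta>) / 12 + \<epsilon> / 24"
    by (simp add: field_simps)
  finally show ?thesis .
qed

section \<open>Affine change of variables\<close>

text \<open>An affine map has constant derivative \<open>A\<close>, so the Jacobian factor leaves
  the integral; \<open>det A \<noteq> 0\<close> makes the map injective.\<close>

lemma set_lebesgue_integral_affine_image:
  fixes f :: "real^2 \<Rightarrow> real" and A :: "real^2^2"
  assumes "compact S" and "det A \<noteq> 0" and contf: "continuous_on ((\<lambda>x. p + A *v x) ` S) f"
  shows "(LINT y:(\<lambda>x. p + A *v x) ` S|lborel. f y)
    = \<bar>det A\<bar> * (LINT x:S|lborel. f (p + A *v x))"
proof -
  let ?g = "\<lambda>x. p + A *v x"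
  \<comment> \<open>The library's change of variables theorem only covers vector-valued integrands.\<close>
  let ?F = "\<lambda>y. vec (f y) :: real^1"
  have contg: "continuous_on S ?g"
    by (intro continuous_intros linear_continuous_on) (simp add: linear_linear)
  then have cI: "compact (?g ` S)"
    using \<open>compact S\<close> by (rule compact_continuous_image)
  have contfg: "continuous_on S (\<lambda>x. f (?g x))"
    using continuous_on_compose2[OF contf contg] by blast
  have i1: "set_integrable lborel (?g ` S) f"
    unfolding set_integrable_def using cI contf by (rule borel_integrable_compact)
  have i2: "set_integrable lborel S (\<lambda>x. f (?g x))"
    unfolding set_integrable_def using \<open>compact S\<close> contfg by (rule borel_integrable_compact)
  have "inj ((*v) A)"
    using \<open>det A \<noteq> 0\<close> by (simp add: inj_matrix_vector_mult invertible_det_nz)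
  then have inj: "inj_on ?g S"
    by (auto simp: inj_on_def)
  have der: "(?g has_derivative (*v) A) (at x within S)" for x
    by (auto intro!: derivative_eq_intros linear_imp_has_derivative)
  have F: "?F absolutely_integrable_on (?g ` S)"
  proof -
    have "f absolutely_integrable_on (?g ` S)"
      using i1 by (simp add: set_integrable_def integrable_completion)
    then show ?thesis
      by (simp add: absolutely_integrable_on_1_iff)
  qed
  have "integral (?g ` S) ?F = integral S (\<lambda>x. \<bar>det (matrix ((*v) A))\<bar> *\<^sub>R ?F (?g x))"
    using \<open>compact S\<close> der inj F
    by (intro integral_change_of_variables) (auto simp: lmeasurable_compact fmeasurableD)
  then have "integral (?g ` S) f = \<bar>det A\<bar> * integral S (\<lambda>x. f (?g x))"
    by (simp add: integral_on_1_eq vec_eq_iff)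
  \<comment> \<open>Both integrands are continuous on compact sets, hence Lebesgue integrable, so
    the gauge integrals equal the Lebesgue integrals.\<close>
  then show ?thesis
    using set_borel_integral_eq_integral(2)[OF i1] set_borel_integral_eq_integral(2)[OF i2] by simp
qed

section \<open>Polynomials of low degree and their derivatives\<close>

lemma poly2_degree_le_1_iff:
  "poly2_degree_le 1 p \<longleftrightarrow> (\<exists>\<alpha> \<beta> \<gamma>. \<forall>x. p x = \<alpha> + \<beta> * x $ 1 + \<gamma> * x $ 2)"
proof -
  have S: "{(i, j). i + j \<le> (1::nat)} = {(0, 0), (1, 0), (0, 1)}"
    by auto
  show ?thesis
  proof
    assume "\<exists>\<alpha> \<beta> \<gamma>. \<forall>x. p x = \<alpha> + \<beta> * x $ 1 + \<gamma> * x $ 2"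
    then obtain \<alpha> \<beta> \<gamma> where p: "\<forall>x. p x = \<alpha> + \<beta> * x $ 1 + \<gamma> * x $ 2"
      by blast
    show "poly2_degree_le 1 p"
      unfolding poly2_degree_le_def S
      by (rule exI[of _ "\<lambda>i j. if i = 1 then \<beta> else if j = 1 then \<gamma> else \<alpha>"]) (simp add: p)
  next
    assume "poly2_degree_le 1 p"
    then obtain k where "\<And>x. p x = (\<Sum>(i, j) \<in> {(i, j). i + j \<le> 1}. k i j * (x $ 1) ^ i * (x $ 2) ^ j)"
      unfolding poly2_degree_le_def by blast
    then have "\<forall>x. p x = k 0 0 + k 1 0 * x $ 1 + k 0 1 * x $ 2"
      unfolding S by simp
    then show "\<exists>\<alpha> \<beta> \<gamma>. \<forall>x. p x = \<alpha> + \<beta> * x $ 1 + \<gamma> * x $ 2"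
      by blast
  qed
qed

lemma poly2_degree_le_2D:
  assumes "poly2_degree_le 2 p"
  obtains \<alpha> \<beta> \<gamma> \<delta> \<epsilon> \<zeta> where
    "\<And>x. p x = \<alpha> + \<beta> * x $ 1 + \<gamma> * x $ 2 + \<delta> * (x $ 1)\<^sup>2 + \<epsilon> * (x $ 1 * x $ 2) + \<zeta> * (x $ 2)\<^sup>2"
proof -
  have S: "{(i, j). i + j \<le> (2::nat)} = {(0, 0), (1, 0), (0, 1), (2, 0), (1, 1), (0, 2)}"
    by auto
  obtain k where "\<And>x. p x = (\<Sum>(i, j) \<in> {(i, j). i + j \<le> 2}. k i j * (x $ 1) ^ i * (x $ 2) ^ j)"
    using assms unfolding poly2_degree_le_def by blast
  then show ?thesis
    unfolding S
    by (intro that[of "k 0 0" "k 1 0" "k 0 1" "k 2 0" "k 1 1" "k 0 2"]) (simp add: algebra_simps)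
qed

lemma gradient_quadratic:
  fixes p :: "real^2 \<Rightarrow> real"
  assumes p: "\<And>x. p x = \<alpha> + \<beta> * x $ 1 + \<gamma> * x $ 2 + \<delta> * (x $ 1)\<^sup>2 + \<epsilon> * (x $ 1 * x $ 2) + \<zeta> * (x $ 2)\<^sup>2"
  shows "gradient p x = vector [\<beta> + 2 * \<delta> * x $ 1 + \<epsilon> * x $ 2, \<gamma> + \<epsilon> * x $ 1 + 2 * \<zeta> * x $ 2]"
proof -
  have "(p has_derivative (\<lambda>h. (\<beta> + 2 * \<delta> * x $ 1 + \<epsilon> * x $ 2) * h $ 1
      + (\<gamma> + \<epsilon> * x $ 1 + 2 * \<zeta> * x $ 2) * h $ 2)) (at x)"
    unfolding p[abs_def]
    by (auto intro!: derivative_eq_intros bounded_linear.has_derivative[OF bounded_linear_vec_nth]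
        simp: algebra_simps)
  then show ?thesis
    by (simp add: gradient_def frechet_derivative_at[symmetric] vec_eq_iff forall_2 axis_def)
qed

text \<open>The gradient of a quadratic is affine, so its Jacobian is its linear part, the same at
  every point.\<close>

lemma hessian_quadratic:
  fixes p :: "real^2 \<Rightarrow> real"
  assumes p: "\<And>x. p x = \<alpha> + \<beta> * x $ 1 + \<gamma> * x $ 2 + \<delta> * (x $ 1)\<^sup>2 + \<epsilon> * (x $ 1 * x $ 2) + \<zeta> * (x $ 2)\<^sup>2"
  shows "hessian p x = vector [vector [2 * \<delta>, \<epsilon>], vector [\<epsilon>, 2 * \<zeta>]]" (is "_ = ?H")
proof -
  have "gradient p = (\<lambda>x. vector [\<beta>, \<gamma>] + ?H *v x)"
    by (rule ext) (simp add: gradient_quadratic[OF p] vec_eq_iff forall_2 matrix_vector_mult_def sum_2)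
  then have "(gradient p has_derivative (*v) ?H) (at x)"
    by (auto intro!: derivative_eq_intros linear_imp_has_derivative)
  then show ?thesis
    by (simp add: hessian_def jacobian_def frechet_derivative_at[symmetric])
qed

section \<open>The interpolant and the geometry of the triangle\<close>

text \<open>The definite description yields these facts only after unique existence is shown.
  Subtracting the condition at \<open>a 1\<close> from the other two leaves a linear system for the
  slopes with determinant \<open>?D\<close>.\<close>

lemma linear_interpolant_affine:
  fixes a :: "3 \<Rightarrow> real^2"
  assumes D: "(a 2 $ 1 - a 1 $ 1) * (a 3 $ 2 - a 1 $ 2) - (a 2 $ 2 - a 1 $ 2) * (a 3 $ 1 - a 1 $ 1) \<noteq> 0"
    (is "?D \<noteq> 0")
  obtains \<alpha> \<beta> \<gamma> where "\<And>x. linear_interpolant a u x = \<alpha> + \<beta> * x $ 1 + \<gamma> * x $ 2"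
    and "\<And>i. linear_interpolant a u (a i) = u (a i)"
proof -
  let ?P = "\<lambda>p. poly2_degree_le 1 p \<and> (\<forall>i. p (a i) = u (a i))"
  have "\<exists>!p. ?P p"
  proof (rule ex_ex1I)
    \<comment> \<open>Cramer's rule for the two slopes; the constant term of \<open>p\<close> is
      then fixed by the value at \<open>a 1\<close>.\<close>
    define \<beta> where "\<beta> = ((u (a 2) - u (a 1)) * (a 3 $ 2 - a 1 $ 2)
      - (u (a 3) - u (a 1)) * (a 2 $ 2 - a 1 $ 2)) / ?D"
    define \<gamma> where "\<gamma> = ((a 2 $ 1 - a 1 $ 1) * (u (a 3) - u (a 1))
      - (a 3 $ 1 - a 1 $ 1) * (u (a 2) - u (a 1))) / ?D"
    define p :: "real^2 \<Rightarrow> real"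
      where "p = (\<lambda>x. (u (a 1) - \<beta> * a 1 $ 1 - \<gamma> * a 1 $ 2) + \<beta> * x $ 1 + \<gamma> * x $ 2)"
    have "\<beta> * ?D = (u (a 2) - u (a 1)) * (a 3 $ 2 - a 1 $ 2) - (u (a 3) - u (a 1)) * (a 2 $ 2 - a 1 $ 2)"
      and "\<gamma> * ?D = (a 2 $ 1 - a 1 $ 1) * (u (a 3) - u (a 1)) - (a 3 $ 1 - a 1 $ 1) * (u (a 2) - u (a 1))"
      using D by (simp_all add: \<beta>_def \<gamma>_def)
    then have "(\<beta> * (a 2 $ 1 - a 1 $ 1) + \<gamma> * (a 2 $ 2 - a 1 $ 2) - (u (a 2) - u (a 1))) * ?D = 0"
      and "(\<beta> * (a 3 $ 1 - a 1 $ 1) + \<gamma> * (a 3 $ 2 - a 1 $ 2) - (u (a 3) - u (a 1))) * ?D = 0"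
      by algebra+
    with D have "\<beta> * (a 2 $ 1 - a 1 $ 1) + \<gamma> * (a 2 $ 2 - a 1 $ 2) = u (a 2) - u (a 1)"
      and "\<beta> * (a 3 $ 1 - a 1 $ 1) + \<gamma> * (a 3 $ 2 - a 1 $ 2) = u (a 3) - u (a 1)"
      by simp_all
    then have "\<forall>i. p (a i) = u (a i)"
      by (simp add: p_def forall_3 algebra_simps)
    moreover have "poly2_degree_le 1 p"
      unfolding poly2_degree_le_1_iff p_def by blast
    ultimately show "\<exists>p. ?P p"
      by blast
  next
    fix p q assume "?P p" and "?P q"
    then obtain \<alpha> \<beta> \<gamma> \<alpha>' \<beta>' \<gamma>' where p: "\<And>x. p x = \<alpha> + \<beta> * x $ 1 + \<gamma> * x $ 2"
      and q: "\<And>x. q x = \<alpha>' + \<beta>' * x $ 1 + \<gamma>' * x $ 2" and eq: "\<And>i. p (a i) = q (a i)"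
      unfolding poly2_degree_le_1_iff by metis
    note e = eq[of 1] eq[of 2] eq[of 3]
    \<comment> \<open>The slope differences solve the homogeneous system with determinant
      \<open>?D\<close>.\<close>
    have "(\<beta> - \<beta>') * ?D = 0" "(\<gamma> - \<gamma>') * ?D = 0"
      using e unfolding p q by algebra+
    with D have "\<beta> = \<beta>'" "\<gamma> = \<gamma>'" by auto
    with e(1) show "p = q" by (auto simp: p q)
  qed
  then have "?P (linear_interpolant a u)"
    unfolding linear_interpolant_def by (rule theI')
  then show ?thesis
    using that unfolding poly2_degree_le_1_iff by blast
qed

text \<open>The coordinates \<open>s\<close>, \<open>t\<close> are the barycentric weights of
  \<open>b\<close> and \<open>c\<close>. As \<open>vector\<close> lists rows, the transpose puts the
  edges into the columns.\<close>

lemma convex_hull_3_eq_affine_image: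
  "convex hull {a, b, c :: real^2}
    = (\<lambda>x. a + transpose (vector [b - a, c - a]) *v x) ` standard_triangle"
proof -
  have eq: "a + transpose (vector [b - a, c - a]) *v x = a + x $ 1 *\<^sub>R (b - a) + x $ 2 *\<^sub>R (c - a)" for x :: "real^2"
    by (simp add: vec_eq_iff matrix_vector_mult_def sum_2 transpose_def algebra_simps)
  show ?thesis
    unfolding convex_hull_3_alt eq
  proof safe
    fix s t :: real assume "0 \<le> s" "0 \<le> t" "s + t \<le> 1"
    then show "a + s *\<^sub>R (b - a) + t *\<^sub>R (c - a) \<in> (\<lambda>x. a + x $ 1 *\<^sub>R (b - a) + x $ 2 *\<^sub>R (c - a)) ` standard_triangle"
      by (intro image_eqI[of _ _ "vector [s, t]"]) (simp_all add: standard_triangle_def)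
  qed (auto simp: standard_triangle_def)
qed

text \<open>A vanishing determinant makes the two edges from \<open>a\<close> parallel.\<close>

lemma not_collinear_imp_det_nonzero:
  fixes a b c :: "real^2"
  assumes "\<not> collinear {a, b, c}"
  shows "(b $ 1 - a $ 1) * (c $ 2 - a $ 2) - (b $ 2 - a $ 2) * (c $ 1 - a $ 1) \<noteq> 0"
proof
  assume D: "(b $ 1 - a $ 1) * (c $ 2 - a $ 2) - (b $ 2 - a $ 2) * (c $ 1 - a $ 1) = 0"
  have "\<not> collinear {0, b - a, c - a}"
    using assms collinear_3[of b a c] by (simp add: insert_commute NO_MATCH_def)
  moreover have "collinear {0, b - a, c - a}"
  \<comment> \<open>The scaling factor is a quotient by a nonzero coordinate of
    \<open>b - a\<close>; if both coordinates vanish, collinearity with 0 is immediate.\<close>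
  proof (cases "b $ 1 = a $ 1")
    case True
    then show ?thesis
      using D unfolding collinear_lemma
      by (auto simp: vec_eq_iff forall_2 intro!: exI[of _ "(c $ 2 - a $ 2) / (b $ 2 - a $ 2)"])
  next
    case False
    then show ?thesis
      using D unfolding collinear_lemma
      by (auto simp: vec_eq_iff forall_2 field_simps intro!: exI[of _ "(c $ 1 - a $ 1) / (b $ 1 - a $ 1)"])
  qed
  ultimately show False by blast
qed

section \<open>The polynomial identity behind the energy formula\<close>

text \<open>The pairs \<open>(P, Q)\<close> with indices 0, 1, 2 stand for \<open>w\<^sub>0\<close>,
  \<open>H b\<close>, \<open>H d\<close>, and \<open>sym\<close> for the symmetry of
  \<open>H\<close>. The bracket is the moment formula applied to the squared norm of the gradient;
  the right side is the sum of the \<open>c i\<close> squared times the squared edge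
  lengths.\<close>

lemma gradient_energy_identity:
  fixes b\<^sub>1 b\<^sub>2 d\<^sub>1 d\<^sub>2 P\<^sub>0 P\<^sub>1 P\<^sub>2 Q\<^sub>0 Q\<^sub>1 Q\<^sub>2 :: real
  defines "D \<equiv> b\<^sub>1 * d\<^sub>2 - b\<^sub>2 * d\<^sub>1"
    and "p \<equiv> b\<^sub>1 * P\<^sub>1 + b\<^sub>2 * Q\<^sub>1" and "q \<equiv> b\<^sub>1 * P\<^sub>2 + b\<^sub>2 * Q\<^sub>2" and "r \<equiv> d\<^sub>1 * P\<^sub>2 + d\<^sub>2 * Q\<^sub>2"
  assumes sym: "d\<^sub>1 * P\<^sub>1 + d\<^sub>2 * Q\<^sub>1 = q"
    and b: "b\<^sub>1 * P\<^sub>0 + b\<^sub>2 * Q\<^sub>0 = - p / 2" and d: "d\<^sub>1 * P\<^sub>0 + d\<^sub>2 * Q\<^sub>0 = - r / 2"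
  shows "24 * D\<^sup>2 * ((P\<^sub>0\<^sup>2 + Q\<^sub>0\<^sup>2) / 2 + (2 * (P\<^sub>0 * P\<^sub>1 + Q\<^sub>0 * Q\<^sub>1) + 2 * (P\<^sub>0 * P\<^sub>2 + Q\<^sub>0 * Q\<^sub>2)) / 6
      + ((P\<^sub>1\<^sup>2 + Q\<^sub>1\<^sup>2) + (P\<^sub>2\<^sup>2 + Q\<^sub>2\<^sup>2)) / 12 + 2 * (P\<^sub>1 * P\<^sub>2 + Q\<^sub>1 * Q\<^sub>2) / 24)
    = q\<^sup>2 * ((d\<^sub>1 - b\<^sub>1)\<^sup>2 + (d\<^sub>2 - b\<^sub>2)\<^sup>2) + (q - p)\<^sup>2 * (d\<^sub>1\<^sup>2 + d\<^sub>2\<^sup>2) + (q - r)\<^sup>2 * (b\<^sub>1\<^sup>2 + b\<^sub>2\<^sup>2)"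
    (is "24 * D\<^sup>2 * ?I = _")
proof -
  \<comment> \<open>Each vector \<open>(P, Q)\<close> is recovered from its inner products with \<open>b\<close> and \<open>d\<close> by Cramer's rule.\<close>
  have P0: "D * P\<^sub>0 = (r * b\<^sub>2 - p * d\<^sub>2) / 2" and Q0: "D * Q\<^sub>0 = (p * d\<^sub>1 - r * b\<^sub>1) / 2"
    using b d unfolding D_def by algebra+
  \<comment> \<open>Here \<open>q\<close> is read through \<open>sym\<close> as the product of
    \<open>d\<close> with \<open>(P\<^sub>1, Q\<^sub>1)\<close>; for index 2 its definition
    serves.\<close>
  have P1: "D * P\<^sub>1 = p * d\<^sub>2 - q * b\<^sub>2" and Q1: "D * Q\<^sub>1 = q * b\<^sub>1 - p * d\<^sub>1"
    unfolding D_def p_def sym[symmetric] by algebra+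
  have P2: "D * P\<^sub>2 = q * d\<^sub>2 - r * b\<^sub>2" and Q2: "D * Q\<^sub>2 = r * b\<^sub>1 - q * d\<^sub>1"
    unfolding D_def q_def r_def by algebra+
  \<comment> \<open>Each term is quadratic in the \<open>P\<close>, \<open>Q\<close>, so
    \<open>D\<^sup>2\<close> supplies one factor \<open>D\<close> to each of its two entries, ready
    for the Cramer formulas.\<close>
  have "24 * D\<^sup>2 * ?I = 12 * ((D * P\<^sub>0)\<^sup>2 + (D * Q\<^sub>0)\<^sup>2)
      + 8 * (D * P\<^sub>0 * (D * P\<^sub>1) + D * Q\<^sub>0 * (D * Q\<^sub>1) + D * P\<^sub>0 * (D * P\<^sub>2) + D * Q\<^sub>0 * (D * Q\<^sub>2))
      + 2 * ((D * P\<^sub>1)\<^sup>2 + (D * Q\<^sub>1)\<^sup>2 + (D * P\<^sub>2)\<^sup>2 + (D * Q\<^sub>2)\<^sup>2)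
      + 2 * (D * P\<^sub>1 * (D * P\<^sub>2) + D * Q\<^sub>1 * (D * Q\<^sub>2))"
    by (simp add: field_simps power2_eq_square)
  also have "\<dots> = q\<^sup>2 * ((d\<^sub>1 - b\<^sub>1)\<^sup>2 + (d\<^sub>2 - b\<^sub>2)\<^sup>2) + (q - p)\<^sup>2 * (d\<^sub>1\<^sup>2 + d\<^sub>2\<^sup>2) + (q - r)\<^sup>2 * (b\<^sub>1\<^sup>2 + b\<^sub>2\<^sup>2)"
    unfolding P0 Q0 P1 Q1 P2 Q2 by (simp add: field_simps power2_eq_square)
  finally show ?thesis .
qed

section \<open>The energy of the interpolation error on a triangle\<close>

theorem theorem3p1:
  fixes a l :: "3 \<Rightarrow> real^2" and K :: "(real^2) set"
    and u :: "real^2 \<Rightarrow> real" and H :: "real^2^2" and c :: "3 \<Rightarrow> real"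
  assumes "\<not> collinear {a 1, a 2, a 3}"
    and "K = convex hull {a 1, a 2, a 3}"
    and "l 1 = a 3 - a 2" and "l 2 = a 1 - a 3" and "l 3 = a 2 - a 1"
    and "poly2_degree_le 2 u"
    and "\<And>x. x \<in> K \<Longrightarrow> hessian u x = H"
    and "\<And>i. c i = l (i + 1) \<bullet> (H *v l (i + 2))"
  shows "(LINT x:K|lborel. (norm (gradient (\<lambda>y. u y - linear_interpolant a u y) x))\<^sup>2)
           = 1 / (48 * measure lborel K) * (\<Sum>i\<in>UNIV. (c i)\<^sup>2 * (norm (l i))\<^sup>2)"
proof -
  define b where "b = a 2 - a 1"
  define d where "d = a 3 - a 1"
  define A where "A = transpose (vector [b, d] :: real^2^2)"
  define D where "D = b $ 1 * d $ 2 - b $ 2 * d $ 1"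
  have det: "det A = D"
    by (simp add: A_def D_def det_2 transpose_def)
  have D: "D \<noteq> 0"
    using not_collinear_imp_det_nonzero[OF assms(1)] by (simp add: D_def b_def d_def)
  have K: "K = (\<lambda>x. a 1 + A *v x) ` standard_triangle"
    unfolding assms(2) A_def b_def d_def by (rule convex_hull_3_eq_affine_image)
  have A: "(A *v x) $ i = b $ i * x $ 1 + d $ i * x $ 2" for x i
    by (simp add: A_def matrix_vector_mult_def sum_2 transpose_def)
  have change: "(LINT x:K|lborel. f x) = \<bar>D\<bar> * (LINT x:standard_triangle|lborel. f (a 1 + A *v x))"
    if "continuous_on K f" for f :: "real^2 \<Rightarrow> real"
    using set_lebesgue_integral_affine_image[OF compact_standard_triangle, of A "a 1" f] that D
    unfolding K det by simp

  have "(LINT x:standard_triangle|lborel. 1 :: real) = 1 / 2"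
    using integral_quadratic_standard_triangle[of "\<lambda>_. 1" 1 0 0 0 0 0] by simp
  then have area: "measure lborel K = \<bar>D\<bar> / 2"
    using change[of "\<lambda>_. 1"] by (simp add: set_lebesgue_integral_def)

  obtain \<alpha> \<beta> \<gamma> \<delta> \<epsilon> \<zeta> where u: "\<And>x. u x
      = \<alpha> + \<beta> * x $ 1 + \<gamma> * x $ 2 + \<delta> * (x $ 1)\<^sup>2 + \<epsilon> * (x $ 1 * x $ 2) + \<zeta> * (x $ 2)\<^sup>2"
    using poly2_degree_le_2D[OF assms(6)] by metis
  obtain \<alpha>' \<beta>' \<gamma>' where lin: "\<And>x. linear_interpolant a u x = \<alpha>' + \<beta>' * x $ 1 + \<gamma>' * x $ 2"
    and interp: "\<And>i. linear_interpolant a u (a i) = u (a i)"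
    using linear_interpolant_affine[of a u] D unfolding D_def b_def d_def by auto
  let ?e = "\<lambda>y. u y - linear_interpolant a u y"
  have e: "?e x = (\<alpha> - \<alpha>') + (\<beta> - \<beta>') * x $ 1 + (\<gamma> - \<gamma>') * x $ 2
      + \<delta> * (x $ 1)\<^sup>2 + \<epsilon> * (x $ 1 * x $ 2) + \<zeta> * (x $ 2)\<^sup>2" for x
    by (simp add: u lin algebra_simps)
  have norm_grad: "(norm (gradient ?e x))\<^sup>2 = (\<beta> - \<beta>' + 2 * \<delta> * x $ 1 + \<epsilon> * x $ 2)\<^sup>2
      + (\<gamma> - \<gamma>' + \<epsilon> * x $ 1 + 2 * \<zeta> * x $ 2)\<^sup>2" for x
    by (subst gradient_quadratic[OF e]) (simp add: norm_vec_def L2_set_def sum_2)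
  \<comment> \<open>Evaluating the Hessian hypothesis at this vertex identifies \<open>H\<close>
    with the coefficient matrix.\<close>
  have "a 1 \<in> K"
    unfolding assms(2) by (simp add: hull_inc)
  then have H: "H = vector [vector [2 * \<delta>, \<epsilon>], vector [\<epsilon>, 2 * \<zeta>]]"
    using assms(7) hessian_quadratic[OF u] by metis

  \<comment> \<open>\<open>(P\<^sub>0, Q\<^sub>0)\<close> is the error gradient at
    \<open>a 1\<close>; the other two pairs are \<open>H b\<close> and \<open>H d\<close>. Then
    \<open>p\<close>, \<open>q\<close>, \<open>r\<close> are the values of the form \<open>H\<close>
    on \<open>(b, b)\<close>, \<open>(b, d)\<close>, \<open>(d, d)\<close>.\<close>
  define P\<^sub>0 where "P\<^sub>0 = \<beta> - \<beta>' + 2 * \<delta> * a 1 $ 1 + \<epsilon> * a 1 $ 2"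
  define Q\<^sub>0 where "Q\<^sub>0 = \<gamma> - \<gamma>' + \<epsilon> * a 1 $ 1 + 2 * \<zeta> * a 1 $ 2"
  define P\<^sub>1 where "P\<^sub>1 = 2 * \<delta> * b $ 1 + \<epsilon> * b $ 2"
  define Q\<^sub>1 where "Q\<^sub>1 = \<epsilon> * b $ 1 + 2 * \<zeta> * b $ 2"
  define P\<^sub>2 where "P\<^sub>2 = 2 * \<delta> * d $ 1 + \<epsilon> * d $ 2"
  define Q\<^sub>2 where "Q\<^sub>2 = \<epsilon> * d $ 1 + 2 * \<zeta> * d $ 2"
  define p where "p = b $ 1 * P\<^sub>1 + b $ 2 * Q\<^sub>1"
  define q where "q = b $ 1 * P\<^sub>2 + b $ 2 * Q\<^sub>2"
  define r where "r = d $ 1 * P\<^sub>2 + d $ 2 * Q\<^sub>2"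
  note PQ = P\<^sub>0_def Q\<^sub>0_def P\<^sub>1_def Q\<^sub>1_def P\<^sub>2_def Q\<^sub>2_def
  define I where "I = (P\<^sub>0\<^sup>2 + Q\<^sub>0\<^sup>2) / 2 + (2 * (P\<^sub>0 * P\<^sub>1 + Q\<^sub>0 * Q\<^sub>1) + 2 * (P\<^sub>0 * P\<^sub>2 + Q\<^sub>0 * Q\<^sub>2)) / 6
      + ((P\<^sub>1\<^sup>2 + Q\<^sub>1\<^sup>2) + (P\<^sub>2\<^sup>2 + Q\<^sub>2\<^sup>2)) / 12 + 2 * (P\<^sub>1 * P\<^sub>2 + Q\<^sub>1 * Q\<^sub>2) / 24"

  have "(norm (gradient ?e (a 1 + A *v x)))\<^sup>2
      = (P\<^sub>0\<^sup>2 + Q\<^sub>0\<^sup>2) + 2 * (P\<^sub>0 * P\<^sub>1 + Q\<^sub>0 * Q\<^sub>1) * x $ 1 + 2 * (P\<^sub>0 * P\<^sub>2 + Q\<^sub>0 * Q\<^sub>2) * x $ 2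
        + (P\<^sub>1\<^sup>2 + Q\<^sub>1\<^sup>2) * (x $ 1)\<^sup>2 + 2 * (P\<^sub>1 * P\<^sub>2 + Q\<^sub>1 * Q\<^sub>2) * (x $ 1 * x $ 2)
        + (P\<^sub>2\<^sup>2 + Q\<^sub>2\<^sup>2) * (x $ 2)\<^sup>2" for x
  proof -
    have "\<beta> - \<beta>' + 2 * \<delta> * (a 1 + A *v x) $ 1 + \<epsilon> * (a 1 + A *v x) $ 2 = P\<^sub>0 + P\<^sub>1 * x $ 1 + P\<^sub>2 * x $ 2"
      and "\<gamma> - \<gamma>' + \<epsilon> * (a 1 + A *v x) $ 1 + 2 * \<zeta> * (a 1 + A *v x) $ 2 = Q\<^sub>0 + Q\<^sub>1 * x $ 1 + Q\<^sub>2 * x $ 2"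
      by (simp_all add: A PQ algebra_simps)
    then show ?thesis
      unfolding norm_grad by (simp add: power2_eq_square algebra_simps)
  qed
  then have "(LINT x:standard_triangle|lborel. (norm (gradient ?e (a 1 + A *v x)))\<^sup>2) = I"
    unfolding I_def by (rule integral_quadratic_standard_triangle)
  moreover have "continuous_on K (\<lambda>x. (norm (gradient ?e x))\<^sup>2)"
    unfolding norm_grad by (intro continuous_intros)
  ultimately have lhs: "(LINT x:K|lborel. (norm (gradient ?e x))\<^sup>2) = \<bar>D\<bar> * I"
    by (simp add: change)

  have a2: "a 2 $ i = a 1 $ i + b $ i" and a3: "a 3 $ i = a 1 $ i + d $ i" for i
    by (simp_all add: b_def d_def)
  have zero: "?e (a i) = 0" for i
    by (simp add: interp)
  \<comment> \<open>Second-order Taylor expansion at \<open>a 1\<close> is exact for a quadratic: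
    the error changes by \<open>w\<^sub>0 \<bullet> b + p / 2\<close> from \<open>a 1\<close> to
    \<open>a 2\<close>, and it is zero at both.\<close>
  have "b $ 1 * P\<^sub>0 + b $ 2 * Q\<^sub>0 = - p / 2"
    using zero[of 1] zero[of 2] unfolding e a2 p_def PQ by algebra
  moreover have "d $ 1 * P\<^sub>0 + d $ 2 * Q\<^sub>0 = - r / 2"
    using zero[of 1] zero[of 3] unfolding e a3 r_def PQ by algebra
  moreover have "d $ 1 * P\<^sub>1 + d $ 2 * Q\<^sub>1 = q"
    unfolding q_def PQ by algebra
  ultimately have I: "24 * D\<^sup>2 * I = q\<^sup>2 * ((d $ 1 - b $ 1)\<^sup>2 + (d $ 2 - b $ 2)\<^sup>2)
      + (q - p)\<^sup>2 * ((d $ 1)\<^sup>2 + (d $ 2)\<^sup>2) + (q - r)\<^sup>2 * ((b $ 1)\<^sup>2 + (b $ 2)\<^sup>2)"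
    unfolding I_def D_def p_def q_def r_def by (intro gradient_energy_identity)

  have l: "l 1 = d - b" "l 2 = - d" "l 3 = b"
    by (simp_all add: assms b_def d_def)
  \<comment> \<open>Evaluating \<open>i + 1\<close> and \<open>i + 2\<close> produces the numerals 4
    and 5, which are 1 and 2 in the type \<open>3\<close>.\<close>
  have l45: "l 4 = d - b" "l 5 = - d"
    using arg_cong[of 4 1 l] arg_cong[of 5 2 l] l by simp_all
  have "c 1 = - q" "c 2 = q - p" "c 3 = q - r"
    by (simp_all add: assms(8) l l45 H inner_vec_def matrix_vector_mult_def sum_2 p_def q_def r_def PQ
        algebra_simps)
  then have "(\<Sum>i\<in>UNIV. (c i)\<^sup>2 * (norm (l i))\<^sup>2) = 24 * D\<^sup>2 * I"
    unfolding I by (simp add: sum_3 l norm_vec_def L2_set_def sum_2)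
  \<comment> \<open>Since 48 times the area is 24 |D|, dividing \<open>24 * D\<^sup>2 * I\<close> by
    it gives |D| times \<open>I\<close>.\<close>
  with lhs area D show ?thesis
    by (simp add: field_simps power2_eq_square abs_mult_self_eq)
qed

end
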